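(* For all real numbers $\Lambda\geqslant 2$ and $\lambda$ with $1<\lambda<\Lambda/(\Lambda-1)$ there exists a $\lambda$-lacunary sequence of positive integers $(n_i)_{i=1}^{\infty}$ such that \[ n_{i+1}>\Lambda n_i \quad\text{for infinitely many indices } i\in\mathbb{N}, \] and for which the set $P((1/n_i)_{i=1}^{\infty})$ contains all rational numbers from the interval $[0,\sum_{i=1}^{\infty}1/n_i)$.
   Context: $\mathbb{N}=\{1,2,3,\ldots\}$. For a real $\lambda>1$, a sequence $(n_i)_{i=1}^{\infty}$ of positive integers is called $\lambda$-lacunary if $n_{i+1}/n_i\geqslant\lambda$ for every $i\in\mathbb{N}$. For a sequence of positive reals $(x_i)_{i=1}^{\infty}$ one denotes \[ P((x_i)_{i=1}^{\infty}) := \Big\{ \sum_{i\in T} x_i \,:\, T\subset\mathbb{N} \text{ finite} \Big\} \] (the empty set $T$ is allowed and gives the sum $0$). *)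

theory Defs
  imports Complex_Main
begin

(* A sequence (n_i) indexed by i = 1, 2, 3, ... is represented by a function on nat whose
   value at i is n_{i+1}; every notion below is invariant under this shift of index. *)

definition lacunary :: "real \<Rightarrow> (nat \<Rightarrow> nat) \<Rightarrow> bool" where
  "lacunary l n \<longleftrightarrow> (\<forall>i. 0 < n i) \<and> (\<forall>i. real (n (Suc i)) / real (n i) \<ge> l)"

definition finite_subsums :: "(nat \<Rightarrow> real) \<Rightarrow> real set" where
  "finite_subsums x = {(\<Sum>i\<in>T. x i) | T. finite T}"

(* The series of reciprocals converges, so its suminf is the genuine sum. *)
lemma lacunary_summable_inverse:
  assumes "1 < l" and "lacunary l n"
  shows "summable (\<lambda>i. 1 / real (n i))"
proof (rule summable_ratio_test[where c = "1 / l" and N = 0])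
  show "1 / l < 1" using assms(1) by simp
  fix i :: nat
  have p: "0 < real (n i)" "0 < real (n (Suc i))" and
    q: "l \<le> real (n (Suc i)) / real (n i)"
    using assms(2) by (auto simp: lacunary_def)
  have "l * real (n i) \<le> real (n (Suc i))"
    using p q by (simp add: field_simps)
  then have "1 / real (n (Suc i)) \<le> 1 / (l * real (n i))"
    using p assms(1) by (intro divide_left_mono) auto
  then show "norm (1 / real (n (Suc i))) \<le> 1 / l * norm (1 / real (n i))"
    by simp
qed

end

theory Submission
  imports Defs "HOL-Number_Theory.Residues"
begin

text \<open>
  Suppose that \<open>M\<close> is a term of the sequence and that all terms up to \<open>M\<close> divide \<open>M\<close>. Their
  reciprocals are \<open>d / M\<close> for a descending list of integers \<open>d\<close> ending in \<open>1\<close>. If every \<open>d\<close> is at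
  most one more than the sum of the smaller ones, then the subset sums of the list are all
  integers from \<open>0\<close> to its total, so the finite subsums of the reciprocals contain every multiple
  of \<open>1 / M\<close> up to their total (\<open>complete_chain_subset_sum\<close>). If this happens for infinitely many
  terms \<open>M\<close>, and every positive integer divides all but finitely many of these \<open>M\<close>, then every
  rational number below the sum of the series is a finite subsum.

  Such lists can be spliced: if \<open>ds\<close> is one of them and \<open>D # es\<close> is another, then so is \<open>ds\<close>
  scaled by \<open>D\<close> and followed by \<open>es\<close>, the final \<open>1\<close> of \<open>ds\<close> having become \<open>D\<close>
  (\<open>complete_chain_splice\<close>). This leaves the denominators of \<open>ds\<close> unchanged and adds new ones
  after them. It therefore suffices to find, for every \<open>q\<close>, a single list (a block) in which
  consecutive ratios are at least \<open>l\<close>, one ratio exceeds \<open>\<Lambda>\<close>, and the largest element is a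
  multiple of \<open>q\<close> and of all the elements (\<open>block_exists\<close>).

  In such a list the next element may always be as large as twice the present largest one.
  A larger jump is possible only if the sum of the elements is large compared with the
  largest. When the elements grow by a ratio close to \<open>l\<close> for a long time, the sum divided by the
  largest element approaches \<open>l / (l - 1)\<close>, and this is greater than \<open>\<Lambda>\<close> exactly because
  \<open>l < \<Lambda> / (\<Lambda> - 1)\<close>. This makes room for the jump (\<open>complete_chain_with_gap\<close>).

  It remains to reach a multiple of a prescribed \<open>L = 2 ^ t * m\<close> with \<open>m\<close> odd, passing only through
  divisors of the number reached. Doubling supplies all powers of two. By Euler's theorem \<open>m\<close>
  divides \<open>2 ^ s - 1\<close> for arbitrarily large \<open>s\<close>, so the single step from \<open>2 ^ s * E\<close> to
  \<open>2 * (2 ^ s - 1) * E\<close>, whose ratio is just below \<open>2\<close> and hence at least \<open>l\<close>, supplies the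
  odd factor.
\<close>

section \<open>Complete chains\<close>

text \<open>The elements descend, so that for a common multiple \<open>M\<close> the quotients \<open>M / d\<close> ascend and
  form an initial part of the lacunary sequence.\<close>

fun complete_chain :: "real \<Rightarrow> nat list \<Rightarrow> bool" where
  "complete_chain l [] \<longleftrightarrow> False"
| "complete_chain l [d] \<longleftrightarrow> d = 1"
| "complete_chain l (y # x # xs) \<longleftrightarrow>
     l * real x \<le> real y \<and> y \<le> 1 + sum_list (x # xs) \<and> complete_chain l (x # xs)"

definition has_gap :: "real \<Rightarrow> nat list \<Rightarrow> bool" where
  "has_gap \<Lambda> ds \<longleftrightarrow> (\<exists>us y x vs. ds = us @ y # x # vs \<and> real y > \<Lambda> * real x)"

lemma has_gap_nth:
  assumes "has_gap \<Lambda> ds"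
  obtains i where "Suc i < length ds" "real (ds ! i) > \<Lambda> * real (ds ! Suc i)"
proof -
  obtain us y x vs where "ds = us @ y # x # vs" "real y > \<Lambda> * real x"
    using assms unfolding has_gap_def by blast
  then show ?thesis by (intro that[of "length us"]) (auto simp: nth_append)
qed

lemma complete_chain_pos:
  assumes "complete_chain l ds" "1 < l" "d \<in> set ds"
  shows "0 < d"
  using assms
proof (induction l ds arbitrary: d rule: complete_chain.induct)
  case (3 l y x xs)
  then have "0 < x" by simp
  then have "0 < l * real x" using 3 by simp
  moreover have "l * real x \<le> real y" using 3 by simp
  ultimately have "0 < y" by linarith
  with 3 show ?case by auto
qed auto

lemma complete_chain_nth:
  assumes "complete_chain l ds" "Suc i < length ds"
  shows "l * real (ds ! Suc i) \<le> real (ds ! i)"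
  using assms
proof (induction l ds arbitrary: i rule: complete_chain.induct)
  case (3 l y x xs)
  then show ?case by (cases i) auto
qed auto

lemma complete_chain_last: "complete_chain l ds \<Longrightarrow> last ds = 1"
  by (induction l ds rule: complete_chain.induct) auto

text \<open>Given a target \<open>m\<close>, either the elements below \<open>y\<close> suffice, or \<open>m\<close> exceeds their sum; then
  \<open>m \<ge> y\<close> by the defining bound on \<open>y\<close>, and \<open>m - y\<close> is within reach of the elements below.\<close>

lemma complete_chain_subset_sum:
  assumes "complete_chain l ds" "m \<le> sum_list ds"
  shows "\<exists>T\<subseteq>{..<length ds}. (\<Sum>i\<in>T. ds ! i) = m"
  using assms
proof (induction l ds arbitrary: m rule: complete_chain.induct)
  case (2 l d)
  then have "m = 0 \<or> m = 1" by auto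
  then show ?case
  proof
    assume "m = 0" then show ?thesis by (intro exI[of _ "{}"]) auto
  next
    assume "m = 1" with 2 show ?thesis by (intro exI[of _ "{0}"]) auto
  qed
next
  case (3 l y x xs)
  have shift: "\<exists>U\<subseteq>{1..<length (y # x # xs)}. (\<Sum>i\<in>U. (y # x # xs) ! i) = k"
    if k: "k \<le> sum_list (x # xs)" for k
  proof -
    obtain T where T: "T \<subseteq> {..<length (x # xs)}" "(\<Sum>i\<in>T. (x # xs) ! i) = k"
      using "3.IH"[of k] "3.prems"(1) k by auto
    have "(\<Sum>i\<in>Suc ` T. (y # x # xs) ! i) = k"
      using T(2) by (subst sum.reindex) auto
    moreover have "Suc ` T \<subseteq> {1..<length (y # x # xs)}" using T(1) by auto
    ultimately show ?thesis by blast
  qed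
  show ?case
  proof (cases "m \<le> sum_list (x # xs)")
    case True
    then obtain U where "U \<subseteq> {1..<length (y # x # xs)}" "(\<Sum>i\<in>U. (y # x # xs) ! i) = m"
      using shift by blast
    then show ?thesis by (intro exI[of _ U]) auto
  next
    case False
    then have y: "y \<le> m" "m - y \<le> sum_list (x # xs)" using "3.prems" by auto
    then obtain U where U: "U \<subseteq> {1..<length (y # x # xs)}" "(\<Sum>i\<in>U. (y # x # xs) ! i) = m - y"
      using shift by blast
    then have "finite U" "0 \<notin> U" by (auto intro: finite_subset)
    then have "(\<Sum>i\<in>insert 0 U. (y # x # xs) ! i) = m" using U(2) y(1) by simp
    then show ?thesis using U(1) by (intro exI[of _ "insert 0 U"]) auto
  qed
qed auto

text \<open>The element \<open>D * y\<close> satisfies the upper bound because the bound for \<open>y\<close>, multiplied by \<open>D\<close>,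
  only lets \<open>D\<close> appear in place of \<open>1\<close>, and \<open>D\<close> itself is at most one more than the sum of \<open>es\<close>.\<close>

lemma complete_chain_splice:
  assumes "complete_chain l ds" "complete_chain l (D # es)"
  shows "complete_chain l (map ((*) D) ds @ es)"
  using assms
proof (induction l ds rule: complete_chain.induct)
  case (3 l y x xs)
  have IH: "complete_chain l (D * x # map ((*) D) xs @ es)" using 3 by simp
  have "real D * (l * real x) \<le> real D * real y"
    using 3 by (intro mult_left_mono) auto
  then have 1: "l * real (D * x) \<le> real (D * y)" by (simp add: mult_ac)
  have D: "D \<le> 1 + sum_list es" using 3(3) by (cases es) auto
  have "D * y \<le> D * (1 + sum_list (x # xs))"
    using 3 by (intro mult_left_mono) auto
  also have "\<dots> = D + (D * x + sum_list (map ((*) D) xs))"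
    by (simp add: distrib_left sum_list_const_mult)
  also have "\<dots> \<le> 1 + sum_list (D * x # map ((*) D) xs @ es)" using D by simp
  finally show ?case using 1 IH by simp
qed auto

lemma complete_chain_top:
  assumes "complete_chain l (x # xs)"
  shows "2 * x \<le> 1 + sum_list (x # xs)"
  using assms by (cases xs) auto

lemma complete_chain_Cons_le_double:
  assumes "complete_chain l (x # xs)" "l * real x \<le> real y" "y \<le> 2 * x"
  shows "complete_chain l (y # x # xs)"
  using assms complete_chain_top[OF assms(1)] by auto

text \<open>The list \<open>ws\<close> of new elements is kept visible, so that divisibility and an earlier gap can be
  tracked through the extension.\<close>

lemma complete_chain_doubling:
  assumes "complete_chain l (x # xs)" "l \<le> 2"
  shows "\<exists>zs ws. complete_chain l (2 ^ c * x # zs) \<and> 2 ^ c * x # zs = ws @ x # xs \<and>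
           (\<forall>w\<in>set ws. w dvd 2 ^ c * x)"
proof (induction c)
  case 0
  then show ?case using assms by (intro exI[of _ xs] exI[of _ "[]"]) auto
next
  case (Suc c)
  then obtain zs ws where IH: "complete_chain l (2 ^ c * x # zs)"
    "2 ^ c * x # zs = ws @ x # xs" "\<forall>w\<in>set ws. w dvd 2 ^ c * x" by blast
  have "l * real (2 ^ c * x) \<le> 2 * real (2 ^ c * x)"
    using assms(2) by (intro mult_right_mono) auto
  then have "complete_chain l (2 ^ Suc c * x # 2 ^ c * x # zs)"
    by (intro complete_chain_Cons_le_double IH) auto
  moreover have "2 ^ Suc c * x # 2 ^ c * x # zs = (2 ^ Suc c * x # ws) @ x # xs"
    using IH(2) by simp
  moreover have "\<forall>w\<in>set (2 ^ Suc c * x # ws). w dvd 2 ^ Suc c * x"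
    using IH(3) by (auto intro: dvd_trans simp: mult_ac)
  ultimately show ?case by blast
qed

section \<open>Opening a gap\<close>

text \<open>
  Each step takes \<open>x\<close> to \<open>y = \<lceil>l * x\<rceil>\<close>. The bound \<open>1 / (\<beta> - l) \<le> x\<close> makes the rounding harmless:
  \<open>l * x + 1 \<le> \<beta> * x\<close>. If \<open>\<rho>\<close> denotes the sum of the list divided by its largest element, then \<open>\<rho>\<close>
  becomes at least \<open>1 + \<rho> / \<beta>\<close>. The fixed point of this map is \<open>\<beta> / (\<beta> - 1)\<close>, and the distance
  to it shrinks by the factor \<open>\<beta>\<close>, whence the form of the lower bound.
\<close>

lemma complete_chain_ratio_growth:
  assumes "1 < l" "l < \<beta>" "\<beta> < 2"
  shows "\<exists>x xs. complete_chain l (x # xs) \<and> 1 / (\<beta> - l) \<le> real x \<and>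
           \<beta> / (\<beta> - 1) * (1 - 1 / \<beta> ^ K) * real x \<le> real (sum_list (x # xs))"
proof (induction K)
  case 0
  obtain a where a: "1 / (\<beta> - l) < 2 ^ a"
    using real_arch_pow[of 2] by auto
  have "complete_chain l [1]" by simp
  from complete_chain_doubling[OF this, of a] assms
  obtain zs where "complete_chain l (2 ^ a # zs)" by auto
  then show ?case using a
    by (intro exI[of _ "2 ^ a"] exI[of _ zs]) (auto simp del: sum_list.Cons)
next
  case (Suc K)
  then obtain x xs where x: "complete_chain l (x # xs)" "1 / (\<beta> - l) \<le> real x"
    "\<beta> / (\<beta> - 1) * (1 - 1 / \<beta> ^ K) * real x \<le> real (sum_list (x # xs))" by blast
  define y where "y = nat \<lceil>l * real x\<rceil>"
  define \<sigma> where "\<sigma> = real (sum_list (x # xs))"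
  have xpos: "0 < real x" using complete_chain_pos[OF x(1) assms(1), of x] by simp
  have y1: "l * real x \<le> real y" unfolding y_def by linarith
  have "0 < l * real x" using xpos assms by simp
  then have "real y \<le> l * real x + 1" unfolding y_def by linarith
  also have "1 \<le> (\<beta> - l) * real x" using x(2) assms by (simp add: field_simps)
  finally have y2: "real y \<le> \<beta> * real x" by (simp add: algebra_simps)
  also have "\<dots> \<le> 2 * real x" using assms by (intro mult_right_mono) auto
  finally have "y \<le> 2 * x" by linarith
  then have 1: "complete_chain l (y # x # xs)"
    by (rule complete_chain_Cons_le_double[OF x(1) y1])
  have "1 * real x \<le> l * real x" using assms by (intro mult_right_mono) auto
  then have 2: "1 / (\<beta> - l) \<le> real y" using x(2) y1 by linarith
  have b: "0 < \<beta>" "0 < \<beta> - 1" using assms by auto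
  have c0: "0 \<le> 1 / (\<beta> - 1) * (1 - 1 / \<beta> ^ K)"
    using assms by simp
  have "\<beta> / (\<beta> - 1) * (1 - 1 / \<beta> ^ Suc K) = 1 + 1 / (\<beta> - 1) * (1 - 1 / \<beta> ^ K)"
    using b by (simp add: field_simps)
  then have "\<beta> / (\<beta> - 1) * (1 - 1 / \<beta> ^ Suc K) * real y
      = real y + 1 / (\<beta> - 1) * (1 - 1 / \<beta> ^ K) * real y" by (simp only: distrib_right mult_1)
  also have "1 / (\<beta> - 1) * (1 - 1 / \<beta> ^ K) * real y
      \<le> 1 / (\<beta> - 1) * (1 - 1 / \<beta> ^ K) * (\<beta> * real x)"
    using y2 c0 by (rule mult_left_mono)
  also have "\<dots> = \<beta> / (\<beta> - 1) * (1 - 1 / \<beta> ^ K) * real x" by simp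
  also have "\<dots> \<le> \<sigma>" using x(3) by (simp only: \<sigma>_def)
  finally have "\<beta> / (\<beta> - 1) * (1 - 1 / \<beta> ^ Suc K) * real y \<le> real (sum_list (y # x # xs))"
    by (simp add: \<sigma>_def)
  with 1 2 show ?case by blast
qed

text \<open>For \<open>\<beta>\<close> slightly above \<open>l\<close> the limit \<open>\<beta> / (\<beta> - 1)\<close> still exceeds \<open>\<Lambda>\<close>, so after enough steps
  the sum is at least \<open>\<Lambda> * x\<close> and the integer just above \<open>\<Lambda> * x\<close> may be the next element.\<close>

lemma complete_chain_with_gap:
  assumes "\<Lambda> \<ge> 2" "1 < l" "l < \<Lambda> / (\<Lambda> - 1)"
  shows "\<exists>y x xs. complete_chain l (y # x # xs) \<and> real y > \<Lambda> * real x"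
proof -
  obtain \<beta> where \<beta>: "l < \<beta>" "\<beta> < \<Lambda> / (\<Lambda> - 1)" using dense assms(3) by blast
  have "\<Lambda> / (\<Lambda> - 1) \<le> 2" using assms(1) by (simp add: field_simps)
  then have b2: "\<beta> < 2" using \<beta> by simp
  have lim: "\<Lambda> < \<beta> / (\<beta> - 1)" using \<beta> assms by (simp add: field_simps)
  define g where "g = \<beta> / (\<beta> - 1)"
  have g: "0 < g" "\<Lambda> < g" using lim assms unfolding g_def by auto
  have "1 < \<beta>" using assms \<beta> by simp
  then obtain K where K: "g / (g - \<Lambda>) < \<beta> ^ K" using real_arch_pow by blast
  have "0 < \<beta> ^ K" using \<open>1 < \<beta>\<close> by simp
  have "g < \<beta> ^ K * (g - \<Lambda>)" using K g by (simp add: pos_divide_less_eq)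
  then have "g / \<beta> ^ K < g - \<Lambda>"
    using \<open>0 < \<beta> ^ K\<close> by (simp add: pos_divide_less_eq mult.commute)
  then have K': "\<Lambda> \<le> g * (1 - 1 / \<beta> ^ K)" by (simp add: algebra_simps)
  obtain x xs where x: "complete_chain l (x # xs)"
    "g * (1 - 1 / \<beta> ^ K) * real x \<le> real (sum_list (x # xs))"
    using complete_chain_ratio_growth[OF assms(2) \<beta>(1) b2] unfolding g_def by blast
  define y where "y = nat \<lfloor>\<Lambda> * real x\<rfloor> + 1"
  have 0: "0 \<le> \<Lambda> * real x" using assms by simp
  have y1: "real y > \<Lambda> * real x" unfolding y_def using 0 by linarith
  have "\<Lambda> * real x \<le> g * (1 - 1 / \<beta> ^ K) * real x"
    using K' by (intro mult_right_mono) auto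
  also note x(2)
  finally have "real y \<le> 1 + real (sum_list (x # xs))" unfolding y_def using 0 by linarith
  then have y2: "y \<le> 1 + sum_list (x # xs)" by linarith
  have "l \<le> \<Lambda>" using \<beta> b2 assms by simp
  then have "l * real x \<le> \<Lambda> * real x" by (intro mult_right_mono) auto
  then have "complete_chain l (y # x # xs)" using x(1) y1 y2 by auto
  then show ?thesis using y1 by blast
qed

section \<open>Blocks whose largest element is a common multiple\<close>

lemma dvd_power_of_two_minus_one:
  fixes m :: nat
  assumes "odd m"
  obtains s where "s \<ge> N" "m dvd 2 ^ s - 1"
proof -
  have "coprime 2 m" using assms by simp
  then have "[2 ^ totient m = 1] (mod m)" by (rule euler_theorem)
  then have "[(2 ^ totient m) ^ N = 1 ^ N] (mod m)" by (rule cong_pow)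
  then have "[2 ^ (totient m * N) = 1] (mod m)" by (simp add: power_mult)
  then have "m dvd 2 ^ (totient m * N) - 1"
    by (subst (asm) cong_sym_eq, simp add: cong_altdef_nat)
  moreover have "totient m * N \<ge> N" using assms odd_pos[of m] by (simp add: Suc_le_eq)
  ultimately show ?thesis using that by blast
qed

text \<open>Let \<open>E\<close> be the element just above the gap and \<open>L\<close> the product of \<open>q\<close> with all elements up to
  \<open>E\<close>. From \<open>E\<close> the chain doubles up to \<open>2 ^ s * E\<close>, steps to \<open>2 * (2 ^ s - 1) * E\<close> and doubles again.
  The last number is a multiple of \<open>L\<close> and of every element passed on the way.\<close>

lemma block_exists:
  assumes "\<Lambda> \<ge> 2" "1 < l" "l < \<Lambda> / (\<Lambda> - 1)" "0 < q"
  shows "\<exists>D es. complete_chain l (D # es) \<and> has_gap \<Lambda> (D # es) \<and> q dvd D \<and>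
           (\<forall>e\<in>set es. e dvd D)"
proof -
  have "\<Lambda> / (\<Lambda> - 1) \<le> 2" using assms(1) by (simp add: field_simps)
  then have l2: "l < 2" using assms by simp
  obtain E x xs where E: "complete_chain l (E # x # xs)" "real E > \<Lambda> * real x"
    using complete_chain_with_gap[OF assms(1-3)] by blast
  define L where "L = q * prod_list (E # x # xs)"
  have "\<forall>d\<in>set (E # x # xs). 0 < d" using complete_chain_pos[OF E(1) assms(2)] by blast
  then have "0 < prod_list (E # x # xs)" using prod_list_zero_iff[of "E # x # xs"] by fastforce
  then have "L \<noteq> 0" using assms(4) by (simp add: L_def)
  then obtain m where m: "L = 2 ^ multiplicity 2 L * m" "\<not> 2 dvd m"
    using multiplicity_decompose'[of L 2] by auto
  define t where "t = multiplicity 2 L"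
  \<comment> \<open>For \<open>s \<ge> N\<close> the ratio \<open>2 * (2 ^ s - 1) / 2 ^ s\<close> is at least \<open>l\<close>.\<close>
  obtain N where N: "2 / (2 - l) < 2 ^ N" using real_arch_pow[of 2] by auto
  obtain s where s: "s \<ge> N" "m dvd 2 ^ s - 1"
    using dvd_power_of_two_minus_one m(2) by blast
  obtain zs ws where z: "complete_chain l (2 ^ s * E # zs)"
    "2 ^ s * E # zs = ws @ E # x # xs" "\<forall>w\<in>set ws. w dvd 2 ^ s * E"
    using complete_chain_doubling[OF E(1), of s] l2 by auto
  define y where "y = 2 * ((2 ^ s - 1) * E)"
  have yr: "real y = (2 * 2 ^ s - 2) * real E" by (simp add: y_def of_nat_diff algebra_simps)
  have "(2::real) ^ N \<le> 2 ^ s" using s(1) by simp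
  then have "2 / (2 - l) \<le> 2 ^ s" using N by linarith
  then have "l * 2 ^ s \<le> 2 * 2 ^ s - 2" using l2 by (simp add: field_simps)
  then have "l * 2 ^ s * real E \<le> (2 * 2 ^ s - 2) * real E" by (intro mult_right_mono) auto
  then have y1: "l * real (2 ^ s * E) \<le> real y" by (simp add: yr mult_ac)
  have y2: "y \<le> 2 * (2 ^ s * E)" by (simp add: y_def)
  have "complete_chain l (y # 2 ^ s * E # zs)"
    by (rule complete_chain_Cons_le_double[OF z(1) y1 y2])
  \<comment> \<open>The factor \<open>2 ^ t\<close> serves \<open>L\<close>, and \<open>2 ^ s\<close> makes up for its loss in the step to \<open>y\<close>.\<close>
  from complete_chain_doubling[OF this, of "t + s"] l2
  obtain es us where e: "complete_chain l (2 ^ (t + s) * y # es)"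
    "2 ^ (t + s) * y # es = us @ y # 2 ^ s * E # zs" "\<forall>u\<in>set us. u dvd 2 ^ (t + s) * y"
    by auto
  define D where "D = 2 ^ (t + s) * y"
  have split: "D # es = us @ y # ws @ E # x # xs" using e(2) z(2) by (simp add: D_def)
  have "2 ^ t * m dvd D" unfolding D_def y_def power_add
    using s(2) by (intro mult_dvd_mono) (auto simp: mult_ac intro: dvd_mult dvd_mult2)
  then have LD: "L dvd D" using m(1) by (simp add: t_def)
  have sD: "2 ^ s * E dvd D" unfolding D_def y_def power_add by (simp add: mult_ac)
  have "d dvd D" if "d \<in> set (D # es)" for d
  proof -
    consider "d \<in> set us" | "d = y" | "d \<in> set ws" | "d \<in> set (E # x # xs)"
      using \<open>d \<in> set (D # es)\<close> unfolding split by auto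
    then show ?thesis
    proof cases
      case 1 then show ?thesis using e(3) by (simp add: D_def)
    next
      case 2 then show ?thesis by (simp add: D_def)
    next
      case 3 then show ?thesis using z(3) sD dvd_trans by blast
    next
      case 4
      then have "d dvd prod_list (E # x # xs)" by (rule prod_list_dvd)
      then show ?thesis using LD dvd_trans unfolding L_def by (meson dvd_mult)
    qed
  qed
  moreover have "q dvd D" using LD unfolding L_def by (rule dvd_mult_left)
  moreover have "has_gap \<Lambda> (D # es)"
    using E(2) unfolding split has_gap_def
    by (intro exI[of _ "us @ y # ws"] exI[of _ E] exI[of _ x] exI[of _ xs]) simp
  moreover have "complete_chain l (D # es)" using e(1) by (simp add: D_def)
  ultimately show ?thesis by (meson list.set_intros(2))
qed

section \<open>Splicing blocks into an infinite sequence\<close>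

primrec spliced :: "(nat \<Rightarrow> nat list) \<Rightarrow> nat \<Rightarrow> nat list" where
  "spliced B 0 = [1]"
| "spliced B (Suc j) = map ((*) (hd (B j))) (spliced B j) @ tl (B j)"

text \<open>Using \<open>fact j\<close> makes every positive integer divide the top of all but finitely many blocks.\<close>

locale block_sequence =
  fixes l \<Lambda> :: real and B :: "nat \<Rightarrow> nat list"
  assumes l_gt_1: "1 < l"
    and chain: "complete_chain l (B j)"
    and gap: "has_gap \<Lambda> (B j)"
    and fact_dvd: "fact j dvd hd (B j)"
    and dvd_top: "d \<in> set (B j) \<Longrightarrow> d dvd hd (B j)"
begin

abbreviation weights :: "nat \<Rightarrow> nat list" where "weights \<equiv> spliced B"

definition common_denom :: "nat \<Rightarrow> nat" where "common_denom j = hd (weights j)"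

text \<open>Reading the term with index \<open>i\<close> off stage \<open>i\<close> is legitimate since this stage has more than \<open>i\<close>
  entries; by \<open>quotient_stable\<close> any other stage that is long enough gives the same value.\<close>

definition denom :: "nat \<Rightarrow> nat" where "denom i = common_denom i div weights i ! i"

lemma block_nonempty: "B j \<noteq> []"
  using chain[of j] by auto

lemma weights_nonempty: "weights j \<noteq> []"
  by (induction j) auto

lemma weights_chain: "complete_chain l (weights j)"
  by (induction j) (auto simp: block_nonempty chain intro!: complete_chain_splice)

lemma common_denom_Suc: "common_denom (Suc j) = hd (B j) * common_denom j"
  using weights_nonempty[of j] by (simp add: common_denom_def hd_map)

lemma weights_pos: "d \<in> set (weights j) \<Longrightarrow> 0 < d"
  using complete_chain_pos[OF weights_chain l_gt_1] by blast

lemma common_denom_pos: "0 < common_denom j"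
  using weights_pos[OF hd_in_set[OF weights_nonempty]] by (simp add: common_denom_def)

lemma weights_dvd: "d \<in> set (weights j) \<Longrightarrow> d dvd common_denom j"
proof (induction j arbitrary: d)
  case 0
  then show ?case by simp
next
  case (Suc j)
  then consider d' where "d' \<in> set (weights j)" "d = hd (B j) * d'" | "d \<in> set (tl (B j))"
    by auto
  then show ?case
  proof cases
    case 1
    then show ?thesis using Suc.IH by (simp add: common_denom_Suc)
  next
    case 2
    then show ?thesis
      using dvd_top[of d j] by (auto simp: common_denom_Suc dest: list.set_sel(2)[OF block_nonempty])
  qed
qed

lemma length_weights: "j < length (weights j)"
proof (induction j)
  case (Suc j)
  obtain i where "Suc i < length (B j)" using has_gap_nth[OF gap] by blast
  with Suc show ?case by simp
qed simp

text \<open>Splicing multiplies the common denominator and the old weights by the same factor.\<close>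

lemma quotient_stable:
  assumes "j \<le> k" "i < length (weights j)"
  shows "i < length (weights k) \<and>
    common_denom k div weights k ! i = common_denom j div weights j ! i"
  using assms(1)
proof (induction k rule: dec_induct)
  case (step k)
  have "0 < hd (B k)"
    using complete_chain_pos[OF chain l_gt_1, of "hd (B k)" k] block_nonempty by simp
  with step show ?case by (auto simp: common_denom_Suc nth_append)
qed (use assms in auto)

lemma denom_times_weight:
  assumes "i < length (weights j)"
  shows "denom i * weights j ! i = common_denom j"
proof -
  have "denom i = common_denom j div weights j ! i"
    unfolding denom_def
    using quotient_stable[of i j i] quotient_stable[of j i i] assms length_weights[of i]
    by (cases "i \<le> j") auto
  then show ?thesis using weights_dvd[of "weights j ! i" j] assms by simp
qed

lemma denom_pos: "0 < denom i"
  using denom_times_weight[OF length_weights, of i] common_denom_pos[of i]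
  by (metis gr0I mult_0 less_irrefl)

lemma weight_eq:
  assumes "i < length (weights j)"
  shows "real (weights j ! i) = real (common_denom j) / real (denom i)"
proof -
  have "real (denom i) * real (weights j ! i) = real (common_denom j)"
    using denom_times_weight[OF assms] by (metis of_nat_mult)
  then show ?thesis using denom_pos[of i] by (simp add: field_simps)
qed

lemma lacunary_denom: "lacunary l denom"
  unfolding lacunary_def
proof (intro conjI allI denom_pos)
  fix i
  have i: "Suc i < length (weights (Suc i))" "i < length (weights (Suc i))"
    using length_weights[of "Suc i"] by auto
  have "l * (real (common_denom (Suc i)) / real (denom (Suc i)))
      \<le> real (common_denom (Suc i)) / real (denom i)"
    using complete_chain_nth[OF weights_chain i(1)] unfolding weight_eq[OF i(1)] weight_eq[OF i(2)] .
  then show "l \<le> real (denom (Suc i)) / real (denom i)"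
    using denom_pos[of i] denom_pos[of "Suc i"] common_denom_pos[of "Suc i"]
    by (simp add: field_simps)
qed

text \<open>The weights of stage \<open>Suc j\<close> end with a full copy of the block \<open>B j\<close>, because the last weight of
  stage \<open>j\<close> is \<open>1\<close> and becomes the top of the block. The gap of \<open>B j\<close> therefore sits beyond the
  first \<open>length (weights j) - 1\<close> terms.\<close>

lemma gap_beyond:
  "\<exists>i\<ge>j. real (denom (Suc i)) > \<Lambda> * real (denom i)"
proof -
  obtain k where k: "Suc k < length (B j)" "real (B j ! k) > \<Lambda> * real (B j ! Suc k)"
    using has_gap_nth[OF gap] by blast
  obtain r where r: "weights j = butlast (weights j) @ [1]"
    using complete_chain_last[OF weights_chain] weights_nonempty
    by (metis append_butlast_last_id)
  define b where "b = length (butlast (weights j))"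
  have "weights (Suc j) = map ((*) (hd (B j))) (butlast (weights j) @ [1]) @ tl (B j)"
    using r by simp
  also have "\<dots> = map ((*) (hd (B j))) (butlast (weights j)) @ B j"
    using block_nonempty[of j] by simp
  finally have w: "weights (Suc j) = map ((*) (hd (B j))) (butlast (weights j)) @ B j" .
  have n: "weights (Suc j) ! (b + k) = B j ! k" "weights (Suc j) ! Suc (b + k) = B j ! Suc k"
    "b + k < length (weights (Suc j))" "Suc (b + k) < length (weights (Suc j))"
    using k(1) unfolding w b_def by (auto simp: nth_append)
  have "\<Lambda> * (real (common_denom (Suc j)) / real (denom (Suc (b + k))))
      < real (common_denom (Suc j)) / real (denom (b + k))"
    using k(2) weight_eq[OF n(3)] weight_eq[OF n(4)] n(1,2) by simp
  then have "real (denom (Suc (b + k))) > \<Lambda> * real (denom (b + k))"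
    using denom_pos[of "b + k"] denom_pos[of "Suc (b + k)"] common_denom_pos[of "Suc j"]
    by (simp add: field_simps)
  moreover have "j \<le> b + k" using length_weights[of j] by (simp add: b_def)
  ultimately show ?thesis by blast
qed

lemma infinite_gaps: "infinite {i. real (denom (Suc i)) > \<Lambda> * real (denom i)}"
  unfolding infinite_nat_iff_unbounded_le using gap_beyond by auto

text \<open>At a late stage the partial sum exceeds \<open>r\<close> and the common denominator \<open>M\<close> is a multiple of the
  denominator of \<open>r\<close>. Then \<open>M * r\<close> is an integer not exceeding the total weight, hence a subset
  sum of the weights.\<close>

lemma rational_is_subsum:
  assumes "r \<in> \<rat>" "0 \<le> r" "r < (\<Sum>i. 1 / real (denom i))"
  shows "r \<in> finite_subsums (\<lambda>i. 1 / real (denom i))"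
proof -
  have "(\<lambda>k. \<Sum>i<k. 1 / real (denom i)) \<longlonglongrightarrow> (\<Sum>i. 1 / real (denom i))"
    by (rule summable_LIMSEQ[OF lacunary_summable_inverse[OF l_gt_1 lacunary_denom]])
  then have "eventually (\<lambda>k. r < (\<Sum>i<k. 1 / real (denom i))) sequentially"
    using assms(3) by (rule order_tendstoD(1))
  then obtain N where N: "r < (\<Sum>i<N. 1 / real (denom i))"
    by (auto simp: eventually_sequentially)
  obtain p q :: nat where pq: "q \<noteq> 0" "\<bar>r\<bar> = real p / real q"
    using Rats_abs_nat_div_natE[OF assms(1)] by metis
  then have r: "r = real p / real q" using assms(2) by simp
  define j where "j = Suc (max N q)"
  define M where "M = common_denom j"
  have "q dvd fact (max N q)" using pq(1) by (intro dvd_fact) auto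
  then have "q dvd M"
    using fact_dvd[of "max N q"] unfolding M_def j_def common_denom_Suc
    by (meson dvd_mult2 dvd_trans)
  then obtain c where c: "M = q * c" by blast
  have Mpos: "0 < real M" using common_denom_pos by (simp add: M_def)
  have rM: "r = real (p * c) / real M" using r c Mpos by auto
  have w: "real (weights j ! i) = real M / real (denom i)" if "i < length (weights j)" for i
    using weight_eq[OF that] by (simp add: M_def)
  have "real (p * c) = real M * r" using rM Mpos by simp
  also have "\<dots> \<le> real M * (\<Sum>i<N. 1 / real (denom i))"
    using N Mpos by (intro mult_left_mono) auto
  also have "\<dots> \<le> real M * (\<Sum>i<length (weights j). 1 / real (denom i))"
    using length_weights[of j] Mpos
    by (intro mult_left_mono sum_mono2) (auto simp: j_def)
  also have "\<dots> = (\<Sum>i<length (weights j). real M * (1 / real (denom i)))"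
    by (simp only: sum_distrib_left)
  also have "\<dots> = (\<Sum>i<length (weights j). real (weights j ! i))"
    using w by (intro sum.cong) auto
  also have "\<dots> = real (sum_list (weights j))"
    by (simp add: sum_list_sum_nth atLeast0LessThan)
  finally have "p * c \<le> sum_list (weights j)" by linarith
  then obtain T where T: "T \<subseteq> {..<length (weights j)}" "(\<Sum>i\<in>T. weights j ! i) = p * c"
    using complete_chain_subset_sum[OF weights_chain] by blast
  have "r = (\<Sum>i\<in>T. real (weights j ! i)) / real M"
    using T(2) rM by (metis of_nat_sum)
  also have "\<dots> = (\<Sum>i\<in>T. real (weights j ! i) / real M)" by (rule sum_divide_distrib)
  also have "\<dots> = (\<Sum>i\<in>T. 1 / real (denom i))"
    using T(1) w Mpos by (intro sum.cong) auto
  finally show ?thesis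
    using finite_subset[OF T(1)] unfolding finite_subsums_def by blast
qed

end

text \<open>A choice of one block for each \<open>j\<close> gives the sequence.\<close>

theorem theorem3:
  fixes \<Lambda> l :: real
  assumes "\<Lambda> \<ge> 2" and "1 < l" and "l < \<Lambda> / (\<Lambda> - 1)"
  shows "\<exists>n :: nat \<Rightarrow> nat.
           lacunary l n \<and>
           infinite {i. real (n (Suc i)) > \<Lambda> * real (n i)} \<and>
           \<rat> \<inter> {0..<(\<Sum>i. 1 / real (n i))} \<subseteq> finite_subsums (\<lambda>i. 1 / real (n i))"
proof -
  have "\<forall>j. \<exists>b. complete_chain l b \<and> has_gap \<Lambda> b \<and> fact j dvd hd b \<and>
          (\<forall>d\<in>set b. d dvd hd b)"
  proof
    fix j :: nat
    obtain D es where "complete_chain l (D # es)" "has_gap \<Lambda> (D # es)" "fact j dvd D"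
      "\<forall>e\<in>set es. e dvd D"
      using block_exists[OF assms, of "fact j"] by auto
    then show "\<exists>b. complete_chain l b \<and> has_gap \<Lambda> b \<and> fact j dvd hd b \<and>
          (\<forall>d\<in>set b. d dvd hd b)"
      by (intro exI[of _ "D # es"]) auto
  qed
  then obtain B where B: "\<And>j. complete_chain l (B j) \<and> has_gap \<Lambda> (B j) \<and>
      fact j dvd hd (B j) \<and> (\<forall>d\<in>set (B j). d dvd hd (B j))"
    by metis
  interpret block_sequence l \<Lambda> B
    using B assms(2) by unfold_locales auto
  show ?thesis
    using lacunary_denom infinite_gaps rational_is_subsum
    by (intro exI[of _ denom]) auto
qed

end
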